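(* Let $\varphi$ be an increasing concave function on $[0,1]$ such that $0<p_\varphi^0\le q_\varphi^0<1$. Then $C\Lambda_\varphi[0,1]=L_1(w)$ (equal as sets with equivalent norms), where $w(t)=\int_0^{1-t}\frac{\varphi'(s)}{t+s}\,ds$.
   Context: Convention: $\varphi(0)=0$, $\varphi>0$ on $(0,1]$. Lorentz space $\Lambda_\varphi$ on $[0,1]$: measurable $f$ with $\|f\|=\int_0^1f^*(s)\,d\varphi(s)<\infty$, $f^*$ the decreasing rearrangement. With $Cf(x)=\frac1x\int_0^xf(t)\,dt$, $C\Lambda_\varphi[0,1]=\{f:C|f|\in\Lambda_\varphi\}$, $\|f\|=\|C|f|\|_{\Lambda_\varphi}$. $L_1(w)$ has norm $\int_0^1|f(t)|w(t)\,dt$. Indices: $\overline\varphi^0(s)=\sup_{0<t\le\min(1,1/s)}\varphi(st)/\varphi(t)$, $p_\varphi^0=\lim_{s\to0^+}\ln\overline\varphi^0(s)/\ln s$, $q_\varphi^0=\lim_{s\to\infty}\ln\overline\varphi^0(s)/\ln s$. *)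

theory Defs
  imports "HOL-Analysis.Analysis"
begin

definition decr_rearr :: "(real \<Rightarrow> ennreal) \<Rightarrow> real \<Rightarrow> ennreal" where
  "decr_rearr g s =
     Inf {y::ennreal. emeasure lebesgue {x\<in>{0..1}. y < g x} \<le> ennreal s}"

definition cesaro_abs :: "(real \<Rightarrow> real) \<Rightarrow> real \<Rightarrow> ennreal" where
  "cesaro_abs f x = (\<integral>\<^sup>+ t\<in>{0..x}. ennreal \<bar>f t\<bar> \<partial>lebesgue) / ennreal x"

definition stieltjes_phi :: "(real \<Rightarrow> real) \<Rightarrow> real measure" where
  "stieltjes_phi \<phi> = interval_measure (\<lambda>t. \<phi> (max 0 (min 1 t)))"

definition lorentz_norm :: "(real \<Rightarrow> real) \<Rightarrow> (real \<Rightarrow> ennreal) \<Rightarrow> ennreal" where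
  "lorentz_norm \<phi> g = (\<integral>\<^sup>+ s\<in>{0..1}. decr_rearr g s \<partial>stieltjes_phi \<phi>)"

definition weight :: "(real \<Rightarrow> real) \<Rightarrow> real \<Rightarrow> ennreal" where
  "weight \<phi> t = (\<integral>\<^sup>+ s\<in>{0..1-t}. ennreal (deriv \<phi> s / (t + s)) \<partial>lebesgue)"

definition L1w_norm :: "(real \<Rightarrow> ennreal) \<Rightarrow> (real \<Rightarrow> real) \<Rightarrow> ennreal" where
  "L1w_norm w f = (\<integral>\<^sup>+ t\<in>{0..1}. ennreal \<bar>f t\<bar> * w t \<partial>lebesgue)"

definition dil_fun :: "(real \<Rightarrow> real) \<Rightarrow> real \<Rightarrow> real" where
  "dil_fun \<phi> s = (SUP t\<in>{0<..min 1 (1/s)}. \<phi> (s * t) / \<phi> t)"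

end

theory Submission
  imports Defs
begin

text \<open>
  Write \<open>F x\<close> for the integral of \<open>\<bar>f\<bar>\<close> over \<open>{0..x}\<close> and \<open>G x = F x / x\<close> for its Cesaro mean.
  The rearrangement \<open>G*\<close> is compared pointwise with integrals of \<open>\<bar>f\<bar>\<close> against explicit kernels,
  and Tonelli's theorem for \<open>d\<phi> \<otimes> dt\<close> turns these comparisons into comparisons of weights.

  Upper bound: \<open>G* s\<close> is at most the supremum of \<open>G\<close> over \<open>{s/2..1 - s/2}\<close>, hence at most the
  integral of \<open>\<bar>f t\<bar> * 3 / (s + t)\<close> over \<open>t \<le> 1 - s/2\<close>. Concavity of \<open>\<phi>\<close> bounds the \<open>d\<phi>\<close>-integral of
  this kernel over \<open>s \<le> 2 (1 - t)\<close> by \<open>6 w t\<close>.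

  Lower bound: \<open>F\<close> is increasing, so \<open>G \<ge> F s / (3 s)\<close> on \<open>{s..3 s}\<close> and \<open>G \<ge> F (1 - 2 s)\<close> on
  \<open>{1 - 2 s..1}\<close>. Both sets have measure \<open>2 s > s\<close>, so \<open>G* s\<close> dominates both constants. This
  controls the weights \<open>\<integral> d\<phi>(s) / s\<close> over \<open>{t..1/3}\<close> and \<open>\<phi> ((1 - t) / 2)\<close>, and the positive lower
  index shows that their sum dominates \<open>w t\<close>.

  Concavity also makes \<open>d\<phi>\<close> absolutely continuous: a supergradient of \<open>\<phi>\<close> is monotone, hence is the
  derivative of \<open>\<phi>\<close> off a countable set, and integrates back to \<open>\<phi>\<close>.
\<close>

section \<open>Concave functions of a real variable\<close>

definition supergradient_on :: "real set \<Rightarrow> (real \<Rightarrow> real) \<Rightarrow> (real \<Rightarrow> real) \<Rightarrow> bool" where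
  "supergradient_on I f g \<longleftrightarrow> (\<forall>x\<in>I. \<forall>y\<in>I. f y \<le> f x + g x * (y - x))"

lemma supergradient_onD:
  "supergradient_on I f g \<Longrightarrow> x \<in> I \<Longrightarrow> y \<in> I \<Longrightarrow> f y \<le> f x + g x * (y - x)"
  by (auto simp: supergradient_on_def)

lemma concave_on_imp_supergradient_on:
  assumes "open I" "concave_on I f"
  obtains g where "supergradient_on I f g"
proof
  let ?g = "\<lambda>x. - Inf ((\<lambda>t. (- f x - - f t) / (x - t)) ` ({x<..} \<inter> I))"
  show "supergradient_on I f ?g"
    unfolding supergradient_on_def
    using convex_le_Inf_differential[of I "\<lambda>x. - f x"] assms
    by (fastforce simp: concave_on_def interior_open)
qed

lemma supergradient_on_mono_on_uminus:
  assumes "supergradient_on I f g"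
  shows "mono_on I (\<lambda>x. - g x)"
proof (rule mono_onI)
  fix x y assume "x \<in> I" "y \<in> I" "x \<le> y"
  then have "g y * (y - x) \<le> g x * (y - x)"
    using supergradient_onD[OF assms, of x y] supergradient_onD[OF assms, of y x]
    by (simp add: algebra_simps)
  then show "- g x \<le> - g y"
    using \<open>x \<le> y\<close> by (cases "x = y") (auto simp: mult_le_cancel_right)
qed

lemma supergradient_on_countable_not_isCont:
  assumes "open I" "supergradient_on I f g"
  shows "countable {x\<in>I. \<not> isCont g x}"
proof -
  have "countable {x\<in>I. \<not> isCont (\<lambda>x. - g x) x}"
    using mono_on_ctble_discont_open[OF \<open>open I\<close> supergradient_on_mono_on_uminus[OF assms(2)]] .
  moreover have "isCont (\<lambda>x. - g x) x = isCont g x" for x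
    using isCont_minus[of x g] isCont_minus[of x "\<lambda>x. - g x"] by auto
  ultimately show ?thesis by simp
qed

lemma supergradient_on_has_real_derivative:
  assumes "open I" "supergradient_on I f g" "x \<in> I" "isCont g x"
  shows "(f has_real_derivative g x) (at x)"
proof -
  have "\<bar>(f y - f x) / (y - x) - g x\<bar> \<le> \<bar>g y - g x\<bar>" if "y \<in> I" "y \<noteq> x" for y
  proof -
    have "f y - f x \<le> g x * (y - x)" "g y * (y - x) \<le> f y - f x"
      using supergradient_onD[OF assms(2) \<open>x \<in> I\<close> \<open>y \<in> I\<close>]
        supergradient_onD[OF assms(2) \<open>y \<in> I\<close> \<open>x \<in> I\<close>] by (simp_all add: algebra_simps)
    then have "if x < y then g y \<le> (f y - f x) / (y - x) \<and> (f y - f x) / (y - x) \<le> g x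
        else g x \<le> (f y - f x) / (y - x) \<and> (f y - f x) / (y - x) \<le> g y"
      using \<open>y \<noteq> x\<close>
      by (simp add: pos_le_divide_eq pos_divide_le_eq neg_le_divide_eq neg_divide_le_eq)
    then show ?thesis by (simp split: if_splits)
  qed
  moreover have "\<forall>\<^sub>F y in at x. y \<in> I \<and> y \<noteq> x"
    using eventually_at_in_open[OF assms(1,3)] by (simp add: eventually_at_filter)
  ultimately have "\<forall>\<^sub>F y in at x. norm ((f y - f x) / (y - x) - g x) \<le> \<bar>g y - g x\<bar>"
    by (auto elim: eventually_mono)
  moreover have "((\<lambda>y. \<bar>g y - g x\<bar>) \<longlongrightarrow> 0) (at x)"
    using \<open>isCont g x\<close> by (simp add: isCont_def tendsto_rabs_zero_iff LIM_zero_iff)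
  ultimately have "((\<lambda>y. (f y - f x) / (y - x) - g x) \<longlongrightarrow> 0) (at x)"
    by (rule Lim_null_comparison)
  then show ?thesis by (simp add: has_field_derivative_iff LIM_zero_iff)
qed

lemma eq_endpoints_of_abs_diff_le:
  fixes D r :: "real \<Rightarrow> real"
  assumes "a \<le> b"
    and bound: "\<And>x y. a \<le> x \<Longrightarrow> x \<le> y \<Longrightarrow> y \<le> b \<Longrightarrow> \<bar>D y - D x\<bar> \<le> (y - x) * (r x - r y)"
  shows "D a = D b"
proof -
  have "real n * \<bar>D b - D a\<bar> \<le> (b - a) * (r a - r b)" if "0 < n" for n :: nat
  proof -
    define h where "h = (b - a) / n"
    define x where "x i = a + real i * h" for i :: nat
    have h: "0 \<le> h" "real n * h = b - a" using that \<open>a \<le> b\<close> by (auto simp: h_def)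
    have ends: "x 0 = a" "x n = b" by (auto simp: x_def h)
    have increment: "\<bar>D (x (Suc i)) - D (x i)\<bar> \<le> h * (r (x i) - r (x (Suc i)))" if "i < n" for i
    proof -
      have "real (Suc i) * h \<le> real n * h"
        using that h(1) by (intro mult_right_mono) auto
      then have "x (Suc i) \<le> b" by (simp add: x_def h)
      moreover have "a \<le> x i" "x i \<le> x (Suc i)" "x (Suc i) - x i = h"
        using h(1) by (auto simp: x_def algebra_simps)
      ultimately show ?thesis using bound[of "x i" "x (Suc i)"] by simp
    qed
    have "\<bar>D b - D a\<bar> = \<bar>\<Sum>i<n. D (x (Suc i)) - D (x i)\<bar>"
      using sum_lessThan_telescope[of "\<lambda>i. D (x i)" n] by (simp add: ends)
    also have "\<dots> \<le> (\<Sum>i<n. h * (r (x i) - r (x (Suc i))))"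
      by (rule order_trans[OF sum_abs sum_mono]) (use increment in auto)
    also have "\<dots> = h * (r a - r b)"
      using sum_lessThan_telescope'[of "\<lambda>i. r (x i)" n] by (simp add: ends flip: sum_distrib_left)
    finally have "real n * \<bar>D b - D a\<bar> \<le> real n * (h * (r a - r b))"
      by (intro mult_left_mono) auto
    then show ?thesis by (simp add: h flip: mult.assoc)
  qed
  then have "\<bar>D b - D a\<bar> = 0" by (intro real_archimedian_rdiv_eq_0) auto
  then show ?thesis by simp
qed

lemma supergradient_on_has_integral:
  assumes g: "supergradient_on I f g" and I: "{a..b} \<subseteq> I" and "a \<le> b"
  shows "(g has_integral f b - f a) {a..b}"
proof -
  have antimono: "g y \<le> g x" if "a \<le> x" "x \<le> y" "y \<le> b" for x y
    using mono_onD[OF supergradient_on_mono_on_uminus[OF g], of x y] that subsetD[OF I] by simp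
  have int: "g integrable_on {x..y}" if "a \<le> x" "y \<le> b" for x y
  proof -
    have "(\<lambda>x. - g x) integrable_on {x..y}"
      using that antimono by (intro integrable_on_mono_on) (auto simp: mono_on_def)
    then show ?thesis by (simp add: integrable_neg_iff)
  qed
  define D where "D x = integral {a..x} g - f x" for x
  have "D a = D b"
  proof (rule eq_endpoints_of_abs_diff_le[OF \<open>a \<le> b\<close>])
    fix x y assume xy: "a \<le> x" "x \<le> y" "y \<le> b"
    have "integral {a..x} g + integral {x..y} g = integral {a..y} g"
      using xy int by (intro Henstock_Kurzweil_Integration.integral_combine) auto
    then have "D y - D x = integral {x..y} g - (f y - f x)" by (simp add: D_def)
    moreover have "x \<in> I" "y \<in> I" using I xy by auto
    then have "f y - f x \<le> (y - x) * g x" "(y - x) * g y \<le> f y - f x"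
      using supergradient_onD[OF g, of x y] supergradient_onD[OF g, of y x]
      by (simp_all add: algebra_simps)
    moreover have "integral {x..y} (\<lambda>_. g y) \<le> integral {x..y} g"
      "integral {x..y} g \<le> integral {x..y} (\<lambda>_. g x)"
      by (intro integral_le; use xy int in \<open>auto intro: antimono\<close>)+
    ultimately show "\<bar>D y - D x\<bar> \<le> (y - x) * (g x - g y)"
      using xy by (simp add: abs_le_iff algebra_simps)
  qed
  then have "integral {a..b} g = f b - f a" by (simp add: D_def)
  then show ?thesis using int[of a b] by (simp add: has_integral_iff)
qed

lemma concave_on_deriv_eq_supergradient:
  assumes "open I" "concave_on I f"
  obtains g S where "supergradient_on I f g" "countable S" "\<And>x. x \<in> I - S \<Longrightarrow> deriv f x = g x"
proof -
  obtain g where g: "supergradient_on I f g"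
    using concave_on_imp_supergradient_on[OF assms] .
  let ?S = "{x\<in>I. \<not> isCont g x}"
  show thesis
  proof
    show "countable ?S" by (rule supergradient_on_countable_not_isCont[OF \<open>open I\<close> g])
    show "deriv f x = g x" if "x \<in> I - ?S" for x
      using that by (intro DERIV_imp_deriv supergradient_on_has_real_derivative[OF \<open>open I\<close> g]) auto
  qed fact
qed

lemma concave_on_borel_measurable_deriv:
  fixes f :: "real \<Rightarrow> real"
  assumes "open I" "concave_on I f"
  shows "(\<lambda>x. ennreal (deriv f x) * indicator I x) \<in> borel_measurable borel"
proof -
  obtain g S where g: "supergradient_on I f g"
    and S: "countable S" "\<And>x. x \<in> I - S \<Longrightarrow> deriv f x = g x"
    using concave_on_deriv_eq_supergradient[OF assms] by metis
  have "(\<lambda>x. - g x) \<in> borel_measurable (restrict_space borel I)"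
    by (rule borel_measurable_mono_on_fnc[OF supergradient_on_mono_on_uminus[OF g]])
  then have "(\<lambda>x. ennreal (g x)) \<in> borel_measurable (restrict_space borel I)"
    by simp
  then have "(\<lambda>x. ennreal (g x) * indicator I x) \<in> borel_measurable borel"
    using \<open>open I\<close> by (subst (asm) borel_measurable_restrict_space_iff_ennreal) auto
  then show ?thesis
    by (rule measurable_discrete_difference[OF _ S(1)]) (use S(2) in \<open>auto simp: indicator_def\<close>)
qed

lemma concave_on_nn_integral_deriv:
  fixes f :: "real \<Rightarrow> real"
  assumes "open I" "concave_on I f" "mono_on I f" "{a..b} \<subseteq> I" "a \<le> b"
  shows "(\<integral>\<^sup>+x\<in>{a<..b}. ennreal (deriv f x) \<partial>lborel) = ennreal (f b - f a)"
proof -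
  obtain g S where g: "supergradient_on I f g"
    and S: "countable S" "\<And>x. x \<in> I - S \<Longrightarrow> deriv f x = g x"
    using concave_on_deriv_eq_supergradient[OF assms(1,2)] by metis
  have g_nonneg: "0 \<le> g x" if "x \<in> I" for x
  proof -
    obtain z where "x < z" "{x..<z} \<subseteq> I"
      using open_right[OF \<open>open I\<close> \<open>x \<in> I\<close>, of "x + 1"] by auto
    moreover obtain y where "x < y" "y < z" using dense[OF \<open>x < z\<close>] by blast
    ultimately have "y \<in> I" by auto
    then have "0 \<le> g x * (y - x)"
      using supergradient_onD[OF g that] monotone_onD[OF assms(3) that] \<open>x < y\<close> by fastforce
    then show ?thesis using \<open>x < y\<close> by (simp add: zero_le_mult_iff)
  qed
  have "AE x in lborel. x \<notin> insert a S"
    using S(1) by (intro AE_not_in countable_imp_null_set_lborel) simp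
  then have "(\<integral>\<^sup>+x\<in>{a<..b}. ennreal (deriv f x) \<partial>lborel) = (\<integral>\<^sup>+x\<in>{a..b}. ennreal (g x) \<partial>lborel)"
    by (intro nn_integral_cong_AE, eventually_elim)
      (use S(2) assms(4) in \<open>auto simp: indicator_def\<close>)
  also have "\<dots> = ennreal (f b - f a)"
    using assms(4,5) g_nonneg
    by (intro nn_integral_has_integral_lebesgue' supergradient_on_has_integral[OF g]) auto
  finally show ?thesis .
qed

section \<open>Measures with a concave distribution function\<close>

lemma measure_eqI_Ioc:
  fixes M N :: "real measure"
  assumes sets: "sets M = sets borel" "sets N = sets borel"
    and finite: "\<And>a b. emeasure M {a<..b} < \<infinity>"
    and eq: "\<And>a b. a \<le> b \<Longrightarrow> emeasure M {a<..b} = emeasure N {a<..b}"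
  shows "M = N"
proof (rule measure_eqI_generator_eq_countable)
  let ?E = "range (\<lambda>(a, b). {a<..b::real})"
  let ?A = "range (\<lambda>n. {- real n<..real n})"
  show "Int_stable ?E"
  proof (rule Int_stableI_image)
    fix i j :: "real \<times> real"
    show "\<exists>k\<in>UNIV. (case i of (a, b) \<Rightarrow> {a<..b}) \<inter> (case j of (a, b) \<Rightarrow> {a<..b})
        = (case k of (a, b) \<Rightarrow> {a<..b})"
      by (intro bexI[of _ "(max (fst i) (fst j), min (snd i) (snd j))"]) (auto split: prod.split)
  qed
  show "?E \<subseteq> Pow UNIV" "?A \<subseteq> ?E" "countable ?A" by auto
  show "sets M = sigma_sets UNIV ?E" "sets N = sigma_sets UNIV ?E"
    by (auto simp: sets borel_sigma_sets_Ioc)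
  show "\<Union> ?A = UNIV"
  proof (intro equalityI subsetI UNIV_I)
    fix x :: real
    obtain n where "\<bar>x\<bar> < real n" using reals_Archimedean2 by blast
    then show "x \<in> \<Union> ?A" by (auto intro!: exI[of _ n])
  qed
  show "emeasure M X \<noteq> \<infinity>" if "X \<in> ?A" for X
    using that finite by (auto simp: less_top)
  show "emeasure M X = emeasure N X" if "X \<in> ?E" for X
  proof -
    from that obtain a b where "X = {a<..b}" by auto
    then show ?thesis using eq[of a b] by (cases "a \<le> b") auto
  qed
qed

lemma UN_shrinking_Ioc: "(\<Union>n. {a + inverse (real (Suc n))<..b}) = {a<..b}"
proof (intro equalityI subsetI)
  fix x assume "x \<in> {a<..b}"
  then obtain n where "inverse (real (Suc n)) < x - a" using reals_Archimedean[of "x - a"] by auto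
  then show "x \<in> (\<Union>n. {a + inverse (real (Suc n))<..b})"
    using \<open>x \<in> {a<..b}\<close> by (auto intro!: exI[of _ n])
next
  fix x assume "x \<in> (\<Union>n. {a + inverse (real (Suc n))<..b})"
  then obtain n where "a + inverse (real (Suc n)) < x" "x \<le> b" by auto
  moreover have "0 < inverse (real (Suc n))" by simp
  ultimately show "x \<in> {a<..b}" unfolding greaterThanAtMost_iff by linarith
qed

lemma emeasure_Ioc_eqI:
  fixes M N :: "real measure"
  assumes sets: "sets M = sets borel" "sets N = sets borel"
    and eq: "\<And>x. a < x \<Longrightarrow> x \<le> b \<Longrightarrow> emeasure M {x<..b} = emeasure N {x<..b}"
  shows "emeasure M {a<..b} = emeasure N {a<..b}"
proof -
  let ?A = "\<lambda>n. {a + inverse (real (Suc n))<..b}"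
  have inc: "incseq ?A"
  proof (intro monoI subsetI)
    fix m n x assume "m \<le> n" "x \<in> ?A m"
    moreover from this have "inverse (real (Suc n)) \<le> inverse (real (Suc m))"
      by (intro le_imp_inverse_le) auto
    ultimately show "x \<in> ?A n" unfolding greaterThanAtMost_iff by linarith
  qed
  have eq_A: "emeasure M (?A n) = emeasure N (?A n)" for n
    using eq[of "a + inverse (real (Suc n))"] by (cases "a + inverse (real (Suc n)) \<le> b") auto
  have "emeasure M {a<..b} = (SUP n. emeasure M (?A n))"
    using inc by (subst SUP_emeasure_incseq) (auto simp: sets UN_shrinking_Ioc simp del: of_nat_Suc)
  also have "\<dots> = (SUP n. emeasure N (?A n))"
    by (simp only: eq_A)
  also have "\<dots> = emeasure N {a<..b}"
    using inc by (subst SUP_emeasure_incseq) (auto simp: sets UN_shrinking_Ioc simp del: of_nat_Suc)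
  finally show ?thesis .
qed

lemma emeasure_interval_measure_Ioc_continuous:
  assumes "mono F" "continuous_on UNIV F" "a \<le> b"
  shows "emeasure (interval_measure F) {a<..b} = ennreal (F b - F a)"
  using assms
  by (intro emeasure_interval_measure_Ioc continuous_on_imp_continuous_within[of UNIV])
    (auto dest: monoD)

lemma interval_measure_eq_density_deriv:
  fixes F :: "real \<Rightarrow> real"
  assumes mono: "mono F" and cont: "continuous_on UNIV F"
    and const: "\<And>x. x \<le> c \<Longrightarrow> F x = F c" and conc: "concave_on {c<..} F"
  shows "interval_measure F = density lborel (\<lambda>x. ennreal (deriv F x) * indicator {c<..} x)"
    (is "?M = ?N")
proof (rule measure_eqI_Ioc)
  note emeasure_M = emeasure_interval_measure_Ioc_continuous[OF mono cont]
  have [measurable]: "(\<lambda>x. ennreal (deriv F x) * indicator {c<..} x) \<in> borel_measurable borel"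
    using conc by (intro concave_on_borel_measurable_deriv) auto
  have emeasure_N: "emeasure ?N X = (\<integral>\<^sup>+x\<in>X. ennreal (deriv F x) * indicator {c<..} x \<partial>lborel)"
    if "X \<in> sets borel" for X
    using that by (simp add: emeasure_density)
  show "emeasure ?M {a<..b} < \<infinity>" for a b
    using emeasure_M[of a b] by (cases "a \<le> b") auto
  show "emeasure ?M {a<..b} = emeasure ?N {a<..b}" if "a \<le> b" for a b
  proof -
    have "F (max c x) = F x" for x
      using const[of x] by (auto simp: max_def)
    then have "emeasure ?M {a<..b} = emeasure ?M {max c a<..max c b}"
      using that by (subst (1 2) emeasure_M) auto
    also have "\<dots> = emeasure ?N {max c a<..max c b}"
    proof (rule emeasure_Ioc_eqI)
      fix x assume x: "max c a < x" "x \<le> max c b"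
      have "emeasure ?N {x<..max c b} = (\<integral>\<^sup>+y\<in>{x<..max c b}. ennreal (deriv F y) \<partial>lborel)"
        by (subst emeasure_N) (use x in \<open>auto simp: indicator_def intro!: nn_integral_cong\<close>)
      also have "\<dots> = ennreal (F (max c b) - F x)"
        using x mono_imp_mono_on[OF mono] conc
        by (intro concave_on_nn_integral_deriv[of "{c<..}"]) auto
      finally show "emeasure ?M {x<..max c b} = emeasure ?N {x<..max c b}"
        by (simp only: emeasure_M[OF x(2)])
    qed simp_all
    also have "\<dots> = emeasure ?N {a<..b}"
      by (subst (1 2) emeasure_N) (auto simp: indicator_def intro!: nn_integral_cong)
    finally show ?thesis .
  qed
qed simp_all

section \<open>Rearrangements of Cesaro means\<close>

lemma borel_measurable_mono_ennreal:
  fixes F :: "real \<Rightarrow> ennreal"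
  assumes "mono F"
  shows "F \<in> borel_measurable borel"
proof (rule borel_measurableI_greater)
  fix y
  have "is_interval {x. y < F x}"
    using monoD[OF assms] by (auto simp: is_interval_1 intro: less_le_trans)
  then show "{x \<in> space borel. y < F x} \<in> sets borel"
    by (simp add: real_interval_borel_measurable)
qed

lemma decr_rearr_le:
  assumes X: "X \<in> sets lebesgue" "emeasure lebesgue X \<le> ennreal s"
    and le: "\<And>x. x \<in> {0..1} \<Longrightarrow> x \<notin> X \<Longrightarrow> G x \<le> c"
  shows "decr_rearr G s \<le> c"
  unfolding decr_rearr_def
proof (rule Inf_lower, rule CollectI)
  have "{x \<in> {0..1}. c < G x} \<subseteq> X" using le by (auto simp: not_le[symmetric])
  then have "emeasure lebesgue {x \<in> {0..1}. c < G x} \<le> emeasure lebesgue X"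
    by (rule emeasure_mono[OF _ X(1)])
  also note X(2)
  finally show "emeasure lebesgue {x \<in> {0..1}. c < G x} \<le> ennreal s" .
qed

lemma le_decr_rearr:
  assumes [measurable]: "G \<in> borel_measurable borel"
    and X: "X \<subseteq> {0..1}" "ennreal s < emeasure lebesgue X"
    and le: "\<And>x. x \<in> X \<Longrightarrow> c \<le> G x"
  shows "c \<le> decr_rearr G s"
  unfolding decr_rearr_def
proof (rule Inf_greatest, rule ccontr)
  fix y assume y: "y \<in> {y. emeasure lebesgue {x \<in> {0..1}. y < G x} \<le> ennreal s}" and "\<not> c \<le> y"
  then have "X \<subseteq> {x \<in> {0..1}. y < G x}" using X(1) le by fastforce
  moreover have "{x \<in> {0..1}. y < G x} \<in> sets lebesgue" by (rule sets_completionI_sets) measurable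
  ultimately have "emeasure lebesgue X \<le> emeasure lebesgue {x \<in> {0..1}. y < G x}"
    by (rule emeasure_mono)
  with X(2) y show False by auto
qed

lemma L1w_norm_eq:
  "L1w_norm w f = (\<integral>\<^sup>+t. ennreal \<bar>f t\<bar> * w t \<partial>lebesgue_on {0..1})"
  by (simp add: L1w_norm_def nn_integral_restrict_space)

lemma L1w_norm_mono:
  assumes "\<And>t. 0 < t \<Longrightarrow> t \<le> 1 \<Longrightarrow> v t \<le> w t"
  shows "L1w_norm v f \<le> L1w_norm w f"
  unfolding L1w_norm_def nn_integral_completion
proof (rule nn_integral_mono_AE)
  show "AE t in lborel. ennreal \<bar>f t\<bar> * v t * indicator {0..1} t
      \<le> ennreal \<bar>f t\<bar> * w t * indicator {0..1} t"
    using AE_lborel_singleton[of 0]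
    by eventually_elim (auto simp: indicator_def intro!: mult_left_mono assms)
qed

lemma measurable_lebesgue_on_of_borel:
  "w \<in> borel_measurable borel \<Longrightarrow> w \<in> borel_measurable (lebesgue_on S)"
  by (simp add: measurable_completion measurable_restrict_space1)

lemma L1w_norm_multc:
  assumes [measurable]: "f \<in> borel_measurable (lebesgue_on {0..1})"
    and w: "w \<in> borel_measurable borel"
  shows "L1w_norm (\<lambda>t. w t * c) f = L1w_norm w f * c"
proof -
  note [measurable] = measurable_lebesgue_on_of_borel[OF w]
  have "L1w_norm (\<lambda>t. w t * c) f = (\<integral>\<^sup>+t. (ennreal \<bar>f t\<bar> * w t) * c \<partial>lebesgue_on {0..1})"
    by (simp add: L1w_norm_eq mult.assoc)
  also have "\<dots> = L1w_norm w f * c"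
    unfolding L1w_norm_eq by (rule nn_integral_multc) measurable
  finally show ?thesis .
qed

lemma L1w_norm_add:
  assumes [measurable]: "f \<in> borel_measurable (lebesgue_on {0..1})"
    and v: "v \<in> borel_measurable borel" and w: "w \<in> borel_measurable borel"
  shows "L1w_norm (\<lambda>t. v t + w t) f = L1w_norm v f + L1w_norm w f"
proof -
  note [measurable] = measurable_lebesgue_on_of_borel[OF v] measurable_lebesgue_on_of_borel[OF w]
  show ?thesis
    unfolding L1w_norm_eq distrib_left by (rule nn_integral_add) measurable
qed

lemma cesaro_abs_eq_L1w_norm:
  "x \<le> 1 \<Longrightarrow> cesaro_abs f x = L1w_norm (indicator {0..x}) f / ennreal x"
  unfolding cesaro_abs_def L1w_norm_def
  by (intro arg_cong2[where f = divide] nn_integral_cong) (auto simp: indicator_def)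

lemma borel_measurable_cesaro_abs [measurable]: "cesaro_abs f \<in> borel_measurable borel"
proof -
  have "mono (\<lambda>x. \<integral>\<^sup>+t\<in>{0..x}. ennreal \<bar>f t\<bar> \<partial>lebesgue)"
    by (intro monoI nn_integral_mono) (auto simp: indicator_def)
  note [measurable] = borel_measurable_mono_ennreal[OF this]
  show ?thesis
    unfolding cesaro_abs_def[abs_def] by measurable
qed

definition upper_kernel :: "real \<Rightarrow> real \<Rightarrow> ennreal" where
  "upper_kernel t s = (if s \<le> 2 * (1 - t) then ennreal (3 / (s + t)) else 0)"

definition near_zero_kernel :: "real \<Rightarrow> real \<Rightarrow> ennreal" where
  "near_zero_kernel t s = (if t \<le> s \<and> s \<le> 1 / 3 then ennreal (1 / (3 * s)) else 0)"

definition near_one_kernel :: "real \<Rightarrow> real \<Rightarrow> ennreal" where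
  "near_one_kernel t s = (if s \<le> (1 - t) / 2 then 1 else 0)"

definition weight_kernel :: "real \<Rightarrow> real \<Rightarrow> ennreal" where
  "weight_kernel t s = (if s \<le> 1 - t then ennreal (1 / (t + s)) else 0)"

lemma borel_measurable_kernels [measurable]:
  "case_prod upper_kernel \<in> borel_measurable (borel \<Otimes>\<^sub>M borel)"
  "case_prod near_zero_kernel \<in> borel_measurable (borel \<Otimes>\<^sub>M borel)"
  "case_prod near_one_kernel \<in> borel_measurable (borel \<Otimes>\<^sub>M borel)"
  "case_prod weight_kernel \<in> borel_measurable (borel \<Otimes>\<^sub>M borel)"
  unfolding upper_kernel_def[abs_def] near_zero_kernel_def[abs_def] near_one_kernel_def[abs_def]
    weight_kernel_def[abs_def]
  by measurable

lemma decr_rearr_cesaro_abs_le: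
  assumes f: "f \<in> borel_measurable (lebesgue_on {0..1})" and s: "0 < s" "s \<le> 1"
  shows "decr_rearr (cesaro_abs f) s \<le> L1w_norm (\<lambda>t. upper_kernel t s) f"
proof (rule decr_rearr_le)
  let ?X = "{0..s / 2} \<union> {1 - s / 2..1}"
  show "?X \<in> sets lebesgue" by simp
  have "emeasure lebesgue ?X \<le> emeasure lebesgue {0..s / 2} + emeasure lebesgue {1 - s / 2..1}"
    by (rule emeasure_subadditive) auto
  also have "\<dots> = ennreal s" using s by (simp flip: ennreal_plus)
  finally show "emeasure lebesgue ?X \<le> ennreal s" .
next
  fix x :: real assume "x \<in> {0..1}" "x \<notin> {0..s / 2} \<union> {1 - s / 2..1}"
  then have x: "s / 2 < x" "x < 1 - s / 2" "0 < x" "x \<le> 1" using s by auto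
  have "cesaro_abs f x = L1w_norm (\<lambda>t. indicator {0..x} t / ennreal x) f"
    using f x by (simp add: cesaro_abs_eq_L1w_norm L1w_norm_multc divide_ennreal_def)
  also have "\<dots> \<le> L1w_norm (\<lambda>t. upper_kernel t s) f"
  proof (rule L1w_norm_mono)
    fix t :: real assume "0 < t" "t \<le> 1"
    then have "inverse x \<le> 3 / (s + t)" if "t \<le> x"
      using that x s by (simp add: field_simps)
    then show "indicator {0..x} t / ennreal x \<le> upper_kernel t s"
      using x by (auto simp: upper_kernel_def divide_ennreal_def inverse_ennreal indicator_def
          intro!: ennreal_leI)
  qed
  finally show "cesaro_abs f x \<le> L1w_norm (\<lambda>t. upper_kernel t s) f" .
qed

lemma le_decr_rearr_cesaro_abs:
  assumes "0 \<le> a" "0 \<le> s" "a + s < b" "b \<le> 1"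
  shows "L1w_norm (indicator {0..a}) f / ennreal b \<le> decr_rearr (cesaro_abs f) s"
proof (rule le_decr_rearr)
  show "{a..b} \<subseteq> {0..1}" using assms by auto
  show "ennreal s < emeasure lebesgue {a..b}" using assms by (simp add: ennreal_less_iff)
  fix x assume x: "x \<in> {a..b}"
  have "L1w_norm (indicator {0..a}) f \<le> L1w_norm (indicator {0..x}) f"
    using x by (intro L1w_norm_mono) (auto simp: indicator_def)
  moreover have "inverse (ennreal b) \<le> inverse (ennreal x)"
    using x assms by (cases "x = 0") (auto simp: inverse_ennreal intro!: ennreal_leI)
  ultimately show "L1w_norm (indicator {0..a}) f / ennreal b \<le> cesaro_abs f x"
    using x assms by (simp add: cesaro_abs_eq_L1w_norm divide_ennreal_def mult_mono)
qed simp

lemma near_zero_kernel_le_decr_rearr: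
  assumes f: "f \<in> borel_measurable (lebesgue_on {0..1})" and s: "0 < s"
  shows "L1w_norm (\<lambda>t. near_zero_kernel t s) f \<le> decr_rearr (cesaro_abs f) s"
proof (cases "s \<le> 1 / 3")
  case True
  have "L1w_norm (\<lambda>t. near_zero_kernel t s) f
      \<le> L1w_norm (\<lambda>t. indicator {0..s} t / ennreal (3 * s)) f"
    using s by (intro L1w_norm_mono) (auto simp: near_zero_kernel_def divide_ennreal_def
        inverse_ennreal inverse_eq_divide indicator_def)
  also have "\<dots> = L1w_norm (indicator {0..s}) f / ennreal (3 * s)"
    unfolding divide_ennreal_def by (rule L1w_norm_multc[OF f]) simp
  also have "\<dots> \<le> decr_rearr (cesaro_abs f) s"
    using s True by (intro le_decr_rearr_cesaro_abs) auto
  finally show ?thesis .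
qed (simp add: near_zero_kernel_def L1w_norm_def)

lemma near_one_kernel_le_decr_rearr:
  assumes "0 < s"
  shows "L1w_norm (\<lambda>t. near_one_kernel t s) f \<le> decr_rearr (cesaro_abs f) s"
proof (cases "s \<le> 1 / 2")
  case True
  have "L1w_norm (\<lambda>t. near_one_kernel t s) f \<le> L1w_norm (indicator {0..1 - 2 * s}) f"
    by (intro L1w_norm_mono) (auto simp: near_one_kernel_def indicator_def)
  also have "\<dots> = L1w_norm (indicator {0..1 - 2 * s}) f / ennreal 1"
    by (simp add: divide_ennreal_def)
  also have "\<dots> \<le> decr_rearr (cesaro_abs f) s"
    using assms True by (intro le_decr_rearr_cesaro_abs) auto
  finally show ?thesis .
next
  case False
  then have "L1w_norm (\<lambda>t. near_one_kernel t s) f \<le> L1w_norm (\<lambda>t. 0) f"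
    by (auto simp: near_one_kernel_def intro!: L1w_norm_mono)
  then show ?thesis by (simp add: L1w_norm_def)
qed

section \<open>Concave functions with vanishing dilation function\<close>

lemma le_dil_fun_mult:
  assumes mono: "mono_on {0..1} \<phi>" and pos: "\<And>t. 0 < t \<Longrightarrow> t \<le> 1 \<Longrightarrow> 0 < \<phi> t"
    and s: "0 < s" "s \<le> 1" and t: "0 < t" "t \<le> 1"
  shows "\<phi> (s * t) \<le> dil_fun \<phi> s * \<phi> t"
proof -
  have "bdd_above ((\<lambda>t. \<phi> (s * t) / \<phi> t) ` {0<..1})"
  proof (rule bdd_aboveI2)
    fix u :: real assume u: "u \<in> {0<..1}"
    then have "s * u \<le> u" "0 < s * u" using s by (auto intro: mult_left_le_one_le)
    then have "\<phi> (s * u) \<le> \<phi> u" using u by (intro mono_onD[OF mono]) auto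
    then show "\<phi> (s * u) / \<phi> u \<le> 1" using pos[of u] u by simp
  qed
  moreover have "min 1 (1 / s) = 1" using s by simp
  ultimately have "\<phi> (s * t) / \<phi> t \<le> dil_fun \<phi> s"
    unfolding dil_fun_def using t by (auto intro!: cSUP_upper)
  then show ?thesis using pos[OF t] by (simp add: field_simps)
qed

lemma tendsto_0_of_ln_ratio_tendsto_pos:
  fixes d :: "real \<Rightarrow> real"
  assumes lim: "((\<lambda>s. ln (d s) / ln s) \<longlongrightarrow> p) (at_right 0)" and "0 < p"
    and pos: "\<forall>\<^sub>F s in at_right 0. 0 < d s"
  shows "(d \<longlongrightarrow> 0) (at_right 0)"
proof -
  have "LIM s at_right 0. ln (d s) / ln s * ln s :> at_bot"
    by (rule filterlim_tendsto_pos_mult_at_bot[OF lim \<open>0 < p\<close> ln_at_0])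
  then have "((\<lambda>s. exp (ln (d s) / ln s * ln s)) \<longlongrightarrow> 0) (at_right 0)"
    by (rule filterlim_compose[OF exp_at_bot])
  moreover have "\<forall>\<^sub>F s in at_right 0. s \<in> {0<..<(1::real)}"
    by (rule eventually_at_rightI[of 0 1]) auto
  with pos have "\<forall>\<^sub>F s in at_right 0. exp (ln (d s) / ln s * ln s) = d s"
    by eventually_elim auto
  ultimately show ?thesis by (rule Lim_transform_eventually)
qed

lemma dil_fun_tendsto_0:
  assumes mono: "mono_on {0..1} \<phi>" and pos: "\<And>t. 0 < t \<Longrightarrow> t \<le> 1 \<Longrightarrow> 0 < \<phi> t"
    and lim: "((\<lambda>s. ln (dil_fun \<phi> s) / ln s) \<longlongrightarrow> p) (at_right 0)" and "0 < p"
  shows "(dil_fun \<phi> \<longlongrightarrow> 0) (at_right 0)"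
proof (rule tendsto_0_of_ln_ratio_tendsto_pos[OF lim \<open>0 < p\<close>])
  have "0 < dil_fun \<phi> s" if s: "s \<in> {0<..<1}" for s
  proof -
    have "0 < \<phi> s" using s by (intro pos) auto
    also have "\<dots> \<le> dil_fun \<phi> s * \<phi> 1"
      using le_dil_fun_mult[OF mono pos, of s 1] s by simp
    finally show ?thesis using pos[of 1] by (simp add: zero_less_mult_iff)
  qed
  then show "\<forall>\<^sub>F s in at_right 0. 0 < dil_fun \<phi> s"
    by (rule eventually_at_rightI[of 0 1]) auto
qed

locale lorentz_function =
  fixes \<phi> :: "real \<Rightarrow> real"
  assumes incr: "mono_on {0..1} \<phi>"
    and conc: "concave_on {0..1} \<phi>"
    and zero: "\<phi> 0 = 0"
    and pos: "\<And>t. 0 < t \<Longrightarrow> t \<le> 1 \<Longrightarrow> 0 < \<phi> t"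
    and dil_fun_tendsto: "(dil_fun \<phi> \<longlongrightarrow> 0) (at_right 0)"
begin

lemma mono: "0 \<le> x \<Longrightarrow> x \<le> y \<Longrightarrow> y \<le> 1 \<Longrightarrow> \<phi> x \<le> \<phi> y"
  using incr by (auto simp: mono_on_def)

lemma nonneg: "0 \<le> x \<Longrightarrow> x \<le> 1 \<Longrightarrow> 0 \<le> \<phi> x"
  using mono[of 0 x] zero by simp

text \<open>
  Extending \<open>\<phi>\<close> by the constant \<open>\<phi> 1\<close> preserves concavity and makes \<open>1\<close> an interior point;
  only at \<open>0\<close> does continuity depend on the dilation function.
\<close>

definition extension :: "real \<Rightarrow> real" where
  "extension t = \<phi> (max 0 (min 1 t))"

lemma extension_eq: "0 \<le> t \<Longrightarrow> t \<le> 1 \<Longrightarrow> extension t = \<phi> t"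
  by (simp add: extension_def)

lemma extension_nonpos: "t \<le> 0 \<Longrightarrow> extension t = 0"
  by (simp add: extension_def zero)

lemma mono_extension: "mono extension"
  unfolding extension_def by (intro monoI mono) auto

lemma extension_nonneg: "0 \<le> extension t"
  unfolding extension_def by (intro nonneg) auto

lemma concave_on_extension: "concave_on {0..} extension"
  unfolding concave_on_iff
proof (intro conjI ballI allI impI)
  fix x y u v :: real
  assume xy: "x \<in> {0..}" "y \<in> {0..}" and uv: "0 \<le> u" "0 \<le> v" "u + v = 1"
  have "u * \<phi> (min 1 x) + v * \<phi> (min 1 y) \<le> \<phi> (u * min 1 x + v * min 1 y)"
    using conc xy uv by (auto simp: concave_on_iff)
  also have "\<dots> \<le> extension (u * x + v * y)"
  proof -
    have "u * min 1 x + v * min 1 y \<le> u * 1 + v * 1" "u * min 1 x + v * min 1 y \<le> u * x + v * y"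
      using uv by (intro add_mono mult_left_mono; simp)+
    then show ?thesis unfolding extension_def using xy uv by (intro mono) auto
  qed
  finally show "u * extension x + v * extension y \<le> extension (u *\<^sub>R x + v *\<^sub>R y)"
    using xy by (simp add: extension_def)
qed simp

lemma concave_on_extension_greaterThan: "concave_on {0<..} extension"
  using concave_on_extension unfolding concave_on_def by (rule convex_on_subset) auto

lemma extension_mult_le:
  assumes "1 \<le> k" "0 \<le> t"
  shows "extension (k * t) \<le> k * extension t"
  using concave_onD[OF concave_on_extension, of "1 / k" 0 "k * t"] assms
  by (simp add: extension_nonpos field_simps)

lemma continuous_on_extension: "continuous_on UNIV extension"
proof -
  have "isCont extension x" for x
  proof (cases x "0::real" rule: linorder_cases)
    case less
    then have "\<forall>\<^sub>F t in nhds x. extension t = 0"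
      by (intro eventually_nhds_in_open[of "{..<0}", THEN eventually_mono])
        (auto simp: extension_nonpos)
    then show ?thesis by (simp add: isCont_cong)
  next
    case greater
    have "continuous_on {0<..} (\<lambda>t. - extension t)"
      using concave_on_extension_greaterThan
      by (intro convex_on_continuous) (auto simp: concave_on_def)
    then have "continuous_on {0<..} extension" using continuous_on_minus by fastforce
    then show ?thesis using greater by (simp add: continuous_on_eq_continuous_at)
  next
    case equal
    have "(extension \<longlongrightarrow> 0) (at_left 0)"
      by (rule tendsto_eventually) (auto simp: eventually_at_filter extension_nonpos)
    moreover have "(extension \<longlongrightarrow> 0) (at_right 0)"
    proof (rule tendsto_sandwich)
      have "\<forall>\<^sub>F t in at_right 0. t \<in> {0<..<(1::real)}"
        by (rule eventually_at_rightI[of 0 1]) auto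
      then show "\<forall>\<^sub>F t in at_right 0. 0 \<le> extension t"
        "\<forall>\<^sub>F t in at_right 0. extension t \<le> dil_fun \<phi> t * \<phi> 1"
        by (eventually_elim;
            use le_dil_fun_mult[OF incr pos, of _ 1] in \<open>auto simp: extension_eq nonneg\<close>)+
      show "((\<lambda>t. dil_fun \<phi> t * \<phi> 1) \<longlongrightarrow> 0) (at_right 0)"
        by (rule tendsto_mult_left_zero[OF dil_fun_tendsto])
    qed simp
    ultimately show ?thesis
      using equal by (simp add: isCont_def filterlim_split_at extension_nonpos)
  qed
  then show ?thesis by (simp add: continuous_at_imp_continuous_on)
qed

definition stieltjes_integral :: "(real \<Rightarrow> ennreal) \<Rightarrow> ennreal" where
  "stieltjes_integral h = (\<integral>\<^sup>+s\<in>{0..1}. h s \<partial>stieltjes_phi \<phi>)"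

lemma stieltjes_phi_eq: "stieltjes_phi \<phi> = interval_measure extension"
  by (simp add: stieltjes_phi_def extension_def[abs_def])

lemma sets_stieltjes_phi [simp, measurable_cong]: "sets (stieltjes_phi \<phi>) = sets borel"
  by (simp add: stieltjes_phi_def)

lemma emeasure_stieltjes_phi_Ioc:
  "a \<le> b \<Longrightarrow> emeasure (stieltjes_phi \<phi>) {a<..b} = ennreal (extension b - extension a)"
  unfolding stieltjes_phi_eq
  by (rule emeasure_interval_measure_Ioc_continuous[OF mono_extension continuous_on_extension])

lemma sigma_finite_stieltjes_phi: "sigma_finite_measure (stieltjes_phi \<phi>)"
  unfolding stieltjes_phi_eq
  using mono_extension continuous_on_extension
  by (intro sigma_finite_interval_measure continuous_on_imp_continuous_within[of UNIV])
    (auto dest: monoD)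

lemma stieltjes_phi_eq_density:
  "stieltjes_phi \<phi> = density lborel (\<lambda>s. ennreal (deriv extension s) * indicator {0<..} s)"
  unfolding stieltjes_phi_eq
  by (rule interval_measure_eq_density_deriv)
    (auto simp: mono_extension continuous_on_extension concave_on_extension_greaterThan
      extension_nonpos)

lemma borel_measurable_deriv_extension [measurable]:
  "(\<lambda>s. ennreal (deriv extension s) * indicator {0<..} s) \<in> borel_measurable borel"
  by (rule concave_on_borel_measurable_deriv[OF _ concave_on_extension_greaterThan]) simp

lemma AE_stieltjes_phi_pos: "AE s in stieltjes_phi \<phi>. 0 < s"
  unfolding stieltjes_phi_eq_density by (subst AE_density) (measurable, auto simp: indicator_def)

lemma stieltjes_integral_eq_lborel:
  assumes [measurable]: "h \<in> borel_measurable borel"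
  shows "stieltjes_integral h = (\<integral>\<^sup>+s\<in>{0..1}. ennreal (deriv \<phi> s) * h s \<partial>lborel)"
proof -
  have "stieltjes_integral h
      = (\<integral>\<^sup>+s. (ennreal (deriv extension s) * indicator {0<..} s)
          * (h s * indicator {0..1} s) \<partial>lborel)"
    unfolding stieltjes_integral_def stieltjes_phi_eq_density
    by (rule nn_integral_density) measurable
  also have "\<dots> = (\<integral>\<^sup>+s\<in>{0..1}. ennreal (deriv \<phi> s) * h s \<partial>lborel)"
  proof (rule nn_integral_cong_AE)
    have deriv_extension: "deriv extension s = deriv \<phi> s" if "s \<in> {0<..<1}" for s
    proof (rule deriv_cong_ev)
      show "\<forall>\<^sub>F t in nhds s. extension t = \<phi> t"
        using that by (intro eventually_nhds_in_open[of "{0<..<1}", THEN eventually_mono])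
          (auto simp: extension_eq)
    qed simp
    show "AE s in lborel.
        (ennreal (deriv extension s) * indicator {0<..} s) * (h s * indicator {0..1} s)
        = ennreal (deriv \<phi> s) * h s * indicator {0..1} s"
      using AE_lborel_singleton[of 0] AE_lborel_singleton[of 1]
      by eventually_elim (auto simp: indicator_def deriv_extension)
  qed
  finally show ?thesis .
qed

lemma weight_eq_stieltjes_integral:
  assumes "0 \<le> t"
  shows "weight \<phi> t = stieltjes_integral (weight_kernel t)"
proof -
  have "weight \<phi> t = (\<integral>\<^sup>+s\<in>{0..1}. ennreal (deriv \<phi> s) * weight_kernel t s \<partial>lborel)"
    unfolding weight_def nn_integral_completion using assms
    by (intro nn_integral_cong)
      (auto simp: weight_kernel_def indicator_def divide_inverse ennreal_mult'')
  then show ?thesis by (simp add: stieltjes_integral_eq_lborel)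
qed

lemma lorentz_norm_eq_stieltjes_integral: "lorentz_norm \<phi> G = stieltjes_integral (decr_rearr G)"
  by (simp add: lorentz_norm_def stieltjes_integral_def)

lemma stieltjes_integral_mono:
  assumes "\<And>s. 0 < s \<Longrightarrow> s \<le> 1 \<Longrightarrow> g s \<le> h s"
  shows "stieltjes_integral g \<le> stieltjes_integral h"
  unfolding stieltjes_integral_def
proof (rule nn_integral_mono_AE)
  show "AE s in stieltjes_phi \<phi>. g s * indicator {0..1} s \<le> h s * indicator {0..1} s"
    using AE_stieltjes_phi_pos by eventually_elim (auto simp: indicator_def intro: assms)
qed

lemma stieltjes_integral_add:
  assumes [measurable]: "g \<in> borel_measurable borel" "h \<in> borel_measurable borel"
  shows "stieltjes_integral (\<lambda>s. g s + h s) = stieltjes_integral g + stieltjes_integral h"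
  unfolding stieltjes_integral_def distrib_right by (rule nn_integral_add) measurable

lemma stieltjes_integral_cmult:
  assumes [measurable]: "h \<in> borel_measurable borel"
  shows "stieltjes_integral (\<lambda>s. c * h s) = c * stieltjes_integral h"
  unfolding stieltjes_integral_def mult.assoc by (rule nn_integral_cmult) measurable

lemma stieltjes_integral_Ioc:
  assumes "0 \<le> a" "a \<le> b"
  shows "stieltjes_integral (indicator {a<..b}) = ennreal (extension b - extension a)"
proof -
  have "stieltjes_integral (indicator {a<..b})
      = (\<integral>\<^sup>+s. indicator {min 1 a<..min 1 b} s \<partial>stieltjes_phi \<phi>)"
    unfolding stieltjes_integral_def using assms
    by (intro nn_integral_cong) (auto simp: indicator_def)
  also have "\<dots> = ennreal (extension (min 1 b) - extension (min 1 a))"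
    using assms by (simp add: emeasure_stieltjes_phi_Ioc)
  also have "\<dots> = ennreal (extension b - extension a)"
    by (simp add: extension_def)
  finally show ?thesis .
qed

lemma stieltjes_integral_Ioc_0:
  "0 \<le> b \<Longrightarrow> stieltjes_integral (indicator {0<..b}) = ennreal (extension b)"
  by (simp add: stieltjes_integral_Ioc extension_nonpos)

lemma borel_measurable_stieltjes_integral [measurable (raw)]:
  assumes [measurable]: "case_prod K \<in> borel_measurable (borel \<Otimes>\<^sub>M borel)"
  shows "(\<lambda>t. stieltjes_integral (K t)) \<in> borel_measurable borel"
proof -
  interpret sigma_finite_measure "stieltjes_phi \<phi>" by (rule sigma_finite_stieltjes_phi)
  show ?thesis unfolding stieltjes_integral_def by measurable
qed

lemma L1w_norm_stieltjes_integral: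
  assumes f: "f \<in> borel_measurable (lebesgue_on {0..1})"
    and K: "case_prod K \<in> borel_measurable (borel \<Otimes>\<^sub>M borel)"
  shows "L1w_norm (\<lambda>t. stieltjes_integral (K t)) f
    = stieltjes_integral (\<lambda>s. L1w_norm (\<lambda>t. K t s) f)"
proof -
  let ?L = "lebesgue_on {0..1::real}"
  interpret L: finite_measure ?L by (rule finite_measure_lebesgue_on) simp
  interpret \<nu>: sigma_finite_measure "stieltjes_phi \<phi>" by (rule sigma_finite_stieltjes_phi)
  interpret pair_sigma_finite ?L "stieltjes_phi \<phi>" ..
  have "(\<lambda>p. (fst p, snd p)) \<in> ?L \<Otimes>\<^sub>M stieltjes_phi \<phi> \<rightarrow>\<^sub>M borel \<Otimes>\<^sub>M borel"
    by (intro measurable_Pair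
        measurable_compose[OF measurable_fst measurable_lebesgue_on_of_borel]) simp_all
  from measurable_compose[OF this K]
  have [measurable]: "case_prod K \<in> borel_measurable (?L \<Otimes>\<^sub>M stieltjes_phi \<phi>)"
    by simp
  note [measurable] = f
  have "L1w_norm (\<lambda>t. stieltjes_integral (K t)) f
      = (\<integral>\<^sup>+t. \<integral>\<^sup>+s. ennreal \<bar>f t\<bar> * (K t s * indicator {0..1} s) \<partial>stieltjes_phi \<phi> \<partial>?L)"
    unfolding L1w_norm_eq stieltjes_integral_def
    by (intro nn_integral_cong nn_integral_cmult[symmetric]) measurable
  also have "\<dots> = (\<integral>\<^sup>+s. \<integral>\<^sup>+t. ennreal \<bar>f t\<bar> * (K t s * indicator {0..1} s) \<partial>?L \<partial>stieltjes_phi \<phi>)"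
    by (rule Fubini'[symmetric]) measurable
  also have "\<dots> = stieltjes_integral (\<lambda>s. L1w_norm (\<lambda>t. K t s) f)"
    unfolding stieltjes_integral_def L1w_norm_eq mult.assoc[symmetric]
    by (intro nn_integral_cong nn_integral_multc) measurable
  finally show ?thesis .
qed

lemma lorentz_norm_le:
  assumes "f \<in> borel_measurable (lebesgue_on {0..1})"
    and "case_prod K \<in> borel_measurable (borel \<Otimes>\<^sub>M borel)"
    and "\<And>s. 0 < s \<Longrightarrow> s \<le> 1 \<Longrightarrow> decr_rearr G s \<le> L1w_norm (\<lambda>t. K t s) f"
  shows "lorentz_norm \<phi> G \<le> L1w_norm (\<lambda>t. stieltjes_integral (K t)) f"
  using assms
  by (simp add: L1w_norm_stieltjes_integral lorentz_norm_eq_stieltjes_integral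
      stieltjes_integral_mono)

lemma le_lorentz_norm:
  assumes "f \<in> borel_measurable (lebesgue_on {0..1})"
    and "case_prod K \<in> borel_measurable (borel \<Otimes>\<^sub>M borel)"
    and "\<And>s. 0 < s \<Longrightarrow> s \<le> 1 \<Longrightarrow> L1w_norm (\<lambda>t. K t s) f \<le> decr_rearr G s"
  shows "L1w_norm (\<lambda>t. stieltjes_integral (K t)) f \<le> lorentz_norm \<phi> G"
  using assms
  by (simp add: L1w_norm_stieltjes_integral lorentz_norm_eq_stieltjes_integral
      stieltjes_integral_mono)

subsection \<open>Kernel estimates\<close>

lemma extension_le_weight_integral:
  assumes "0 < t" "t \<le> 1"
  shows "ennreal (extension (1 - t)) \<le> stieltjes_integral (weight_kernel t)"
proof -
  have "ennreal (extension (1 - t)) = stieltjes_integral (indicator {0<..1 - t})"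
    using assms by (simp add: stieltjes_integral_Ioc_0)
  also have "\<dots> \<le> stieltjes_integral (weight_kernel t)"
    using assms
    by (intro stieltjes_integral_mono) (auto simp: weight_kernel_def indicator_def ennreal_ge_1)
  finally show ?thesis .
qed

lemma upper_kernel_integral_le:
  assumes "0 < t" "t \<le> 1"
  shows "stieltjes_integral (upper_kernel t) \<le> stieltjes_integral (weight_kernel t) * 6"
proof -
  let ?w = "stieltjes_integral (weight_kernel t)"
  have "stieltjes_integral (upper_kernel t)
      \<le> stieltjes_integral (\<lambda>s. 3 * weight_kernel t s + 3 * indicator {1 - t<..2 * (1 - t)} s)"
  proof (rule stieltjes_integral_mono)
    fix s :: real assume "0 < s"
    then have "ennreal (3 / (s + t)) = 3 * ennreal (1 / (t + s))"
      using assms by (simp flip: ennreal_numeral ennreal_mult add: add.commute)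
    moreover have "ennreal (3 / (s + t)) \<le> 3" if "1 - t < s"
      using that assms by (simp flip: ennreal_numeral add: field_simps)
    ultimately show "upper_kernel t s
        \<le> 3 * weight_kernel t s + 3 * indicator {1 - t<..2 * (1 - t)} s"
      by (auto simp: upper_kernel_def weight_kernel_def indicator_def)
  qed
  also have "\<dots> = 3 * ?w + 3 * ennreal (extension (2 * (1 - t)) - extension (1 - t))"
    using assms by (simp add: stieltjes_integral_add stieltjes_integral_cmult stieltjes_integral_Ioc)
  also have "\<dots> \<le> 3 * ?w + 3 * ?w"
  proof (intro add_left_mono mult_left_mono)
    have "ennreal (extension (2 * (1 - t)) - extension (1 - t)) \<le> ennreal (extension (1 - t))"
      using extension_mult_le[of 2 "1 - t"] assms by (intro ennreal_leI) auto
    also have "\<dots> \<le> ?w" using assms by (rule extension_le_weight_integral)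
    finally show "ennreal (extension (2 * (1 - t)) - extension (1 - t)) \<le> ?w" .
  qed simp
  also have "\<dots> = ?w * 6" by (simp add: mult.commute flip: distrib_right)
  finally show ?thesis .
qed

lemma weight_integral_le_split:
  assumes "0 < t"
  shows "stieltjes_integral (weight_kernel t) \<le> ennreal (1 / t) * ennreal (extension t)
    + 3 * stieltjes_integral (near_zero_kernel t) + 3 * ennreal (extension 1)"
proof -
  have "stieltjes_integral (weight_kernel t) \<le> stieltjes_integral (\<lambda>s.
      ennreal (1 / t) * indicator {0<..t} s + 3 * near_zero_kernel t s + 3 * indicator {0<..1} s)"
  proof (rule stieltjes_integral_mono)
    fix s :: real assume s: "0 < s" "s \<le> 1"
    consider (near_zero) "s \<le> t" | (middle) "t < s" "s \<le> 1 / 3" | (far) "1 / 3 < s" by linarith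
    then show "weight_kernel t s
      \<le> ennreal (1 / t) * indicator {0<..t} s + 3 * near_zero_kernel t s + 3 * indicator {0<..1} s"
    proof cases
      case near_zero
      then have "weight_kernel t s \<le> ennreal (1 / t) * indicator {0<..t} s"
        using s assms by (auto simp: weight_kernel_def intro!: ennreal_leI divide_left_mono)
      then show ?thesis by (simp add: add_increasing2)
    next
      case middle
      then have "ennreal (1 / (t + s)) \<le> ennreal (1 / s)"
        using s assms by (intro ennreal_leI divide_left_mono) auto
      also have "\<dots> = 3 * ennreal (1 / (3 * s))"
        using s by (simp flip: ennreal_numeral ennreal_mult)
      finally have "weight_kernel t s \<le> 3 * near_zero_kernel t s"
        using middle by (simp add: weight_kernel_def near_zero_kernel_def)
      then show ?thesis by (simp add: add_increasing2 add_increasing)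
    next
      case far
      then have "weight_kernel t s \<le> 3"
        using assms by (auto simp: weight_kernel_def field_simps simp flip: ennreal_numeral)
      then show ?thesis using s by (simp add: add_increasing)
    qed
  qed
  then show ?thesis
    using assms by (simp add: stieltjes_integral_add stieltjes_integral_cmult stieltjes_integral_Ioc_0)
qed

lemma halving_dilation:
  obtains a where "0 < a" "a < 1" "\<And>t. 0 < t \<Longrightarrow> t \<le> 1 \<Longrightarrow> 2 * extension (a * t) \<le> extension t"
proof -
  have "\<forall>\<^sub>F a in at_right 0. dil_fun \<phi> a < 1 / 2"
    by (rule order_tendstoD(2)[OF dil_fun_tendsto]) simp
  moreover have "\<forall>\<^sub>F a in at_right 0. a \<in> {0<..<(1::real)}"
    by (rule eventually_at_rightI[of 0 1]) auto
  ultimately have "\<forall>\<^sub>F a in at_right 0. dil_fun \<phi> a < 1 / 2 \<and> a \<in> {0<..<1}"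
    by eventually_elim simp
  then obtain a where a: "dil_fun \<phi> a < 1 / 2" "0 < a" "a < 1"
    using eventually_happens'[OF trivial_limit_at_right_real] by fastforce
  have "2 * extension (a * t) \<le> extension t" if t: "0 < t" "t \<le> 1" for t
  proof -
    have "\<phi> (a * t) \<le> dil_fun \<phi> a * \<phi> t" using a t by (intro le_dil_fun_mult[OF incr pos]) auto
    also have "\<dots> \<le> 1 / 2 * \<phi> t" using a t by (intro mult_right_mono nonneg) auto
    finally show ?thesis using a t by (simp add: extension_eq mult_le_one)
  qed
  with a show thesis by (intro that)
qed

text \<open>
  The contribution of \<open>s \<le> t\<close> to the weight is of order \<open>\<phi> t / t\<close>. Since \<open>\<phi>\<close> at least doubles
  between \<open>t\<close> and \<open>t / a\<close>, the \<open>d\<phi>\<close>-integral of \<open>1 / s\<close> over that interval absorbs it.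
\<close>

lemma quotient_le_near_zero_integral:
  assumes a: "0 < a" "a < 1" "2 * extension t \<le> extension (t / a)" and t: "0 < t" "t \<le> a / 3"
  shows "ennreal (1 / t) * ennreal (extension t)
    \<le> ennreal (3 / a) * stieltjes_integral (near_zero_kernel t)"
proof -
  define u where "u = t / a"
  have u: "t < u" "u \<le> 1 / 3" "0 < u" using a t by (auto simp: u_def field_simps)
  have "1 / t * extension t \<le> 3 / a * (1 / (3 * u) * (extension u - extension t))"
    using a t by (simp add: u_def field_simps)
  then have "ennreal (1 / t) * ennreal (extension t)
      \<le> ennreal (3 / a) * (ennreal (1 / (3 * u)) * ennreal (extension u - extension t))"
    using a t u extension_nonneg[of t] monoD[OF mono_extension, of t u]
    by (simp flip: ennreal_mult add: ennreal_leI)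
  also have "ennreal (1 / (3 * u)) * ennreal (extension u - extension t)
      = stieltjes_integral (\<lambda>s. ennreal (1 / (3 * u)) * indicator {t<..u} s)"
    using t u by (simp add: stieltjes_integral_cmult stieltjes_integral_Ioc)
  also have "\<dots> \<le> stieltjes_integral (near_zero_kernel t)"
    using t u by (intro stieltjes_integral_mono)
      (auto simp: near_zero_kernel_def indicator_def intro!: ennreal_leI divide_left_mono)
  finally show ?thesis by (simp add: mult_left_mono)
qed

lemma extension_le_near_one_integral:
  assumes "t \<le> 1" "1 \<le> k" "x \<le> k * ((1 - t) / 2)"
  shows "ennreal (extension x) \<le> ennreal k * stieltjes_integral (near_one_kernel t)"
proof -
  have "extension x \<le> extension (k * ((1 - t) / 2))"
    using assms(3) by (rule monoD[OF mono_extension])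
  also have "\<dots> \<le> k * extension ((1 - t) / 2)"
    using assms by (intro extension_mult_le) auto
  finally have "ennreal (extension x) \<le> ennreal k * ennreal (extension ((1 - t) / 2))"
    using assms by (simp add: ennreal_leI extension_nonneg flip: ennreal_mult)
  also have "ennreal (extension ((1 - t) / 2)) = stieltjes_integral (indicator {0<..(1 - t) / 2})"
    using assms by (simp add: stieltjes_integral_Ioc_0)
  also have "\<dots> \<le> stieltjes_integral (near_one_kernel t)"
    by (intro stieltjes_integral_mono) (auto simp: near_one_kernel_def indicator_def)
  finally show ?thesis by (simp add: mult_left_mono)
qed

lemma weight_integral_le_near_one_integral:
  assumes "0 < t" "t \<le> 1"
  shows "stieltjes_integral (weight_kernel t)
    \<le> stieltjes_integral (near_one_kernel t) * ennreal (2 / t)"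
proof -
  let ?near_one = "stieltjes_integral (near_one_kernel t)"
  have "stieltjes_integral (weight_kernel t)
      \<le> stieltjes_integral (\<lambda>s. ennreal (1 / t) * indicator {0<..1 - t} s)"
    using assms by (intro stieltjes_integral_mono)
      (auto simp: weight_kernel_def indicator_def intro!: ennreal_leI divide_left_mono)
  also have "\<dots> = ennreal (1 / t) * ennreal (extension (1 - t))"
    using assms by (simp add: stieltjes_integral_cmult stieltjes_integral_Ioc_0)
  also have "\<dots> \<le> ennreal (1 / t) * (2 * ?near_one)"
    using extension_le_near_one_integral[of t 2 "1 - t"] assms by (intro mult_left_mono) auto
  also have "\<dots> = ?near_one * ennreal (2 / t)"
    using assms by (simp add: mult_ac flip: ennreal_numeral ennreal_mult mult.assoc)
  finally show ?thesis .
qed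

lemma weight_integral_le_near_kernels:
  obtains C where "0 < C" "\<And>t. 0 < t \<Longrightarrow> t \<le> 1 \<Longrightarrow> stieltjes_integral (weight_kernel t)
    \<le> (stieltjes_integral (near_zero_kernel t) + stieltjes_integral (near_one_kernel t)) * ennreal C"
proof -
  obtain a where a: "0 < a" "a < 1"
    and halving: "\<And>t. 0 < t \<Longrightarrow> t \<le> 1 \<Longrightarrow> 2 * extension (a * t) \<le> extension t"
    using halving_dilation by blast
  have "stieltjes_integral (weight_kernel t)
      \<le> (stieltjes_integral (near_zero_kernel t) + stieltjes_integral (near_one_kernel t))
        * ennreal (9 / a)"
    (is "?w \<le> (?zero + ?one) * _") if t: "0 < t" "t \<le> 1" for t
  proof (cases "t \<le> a / 3")
    case False
    have "?w \<le> ?one * ennreal (2 / t)"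
      using t by (rule weight_integral_le_near_one_integral)
    also have "\<dots> \<le> (?zero + ?one) * ennreal (9 / a)"
      using False a t by (intro mult_mono ennreal_leI) (auto simp: field_simps)
    finally show ?thesis .
  next
    case True
    have "?w \<le> ennreal (1 / t) * ennreal (extension t) + 3 * ?zero + 3 * ennreal (extension 1)"
      using t by (intro weight_integral_le_split) auto
    also have "\<dots> \<le> ennreal (3 / a) * ?zero + 3 * ?zero + 3 * (3 * ?one)"
    proof (intro add_mono mult_left_mono order_refl)
      show "ennreal (1 / t) * ennreal (extension t) \<le> ennreal (3 / a) * ?zero"
        using halving[of "t / a"] a t True
        by (intro quotient_le_near_zero_integral) (auto simp: field_simps)
      show "ennreal (extension 1) \<le> 3 * ?one"
        using extension_le_near_one_integral[of t 3 1] a True t by auto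
    qed auto
    also have "\<dots> = ?zero * ennreal (3 / a + 3) + ?one * ennreal 9"
      using a by (simp add: algebra_simps)
    also have "\<dots> \<le> ?zero * ennreal (9 / a) + ?one * ennreal (9 / a)"
      using a by (intro add_mono mult_left_mono ennreal_leI) (auto simp: field_simps)
    finally show ?thesis by (simp add: distrib_right)
  qed
  with a show thesis by (intro that[of "9 / a"]) auto
qed

lemma L1w_norm_weight:
  "L1w_norm (weight \<phi>) f = L1w_norm (\<lambda>t. stieltjes_integral (weight_kernel t)) f"
  by (intro antisym L1w_norm_mono) (simp_all add: weight_eq_stieltjes_integral)

lemma lorentz_norm_cesaro_abs_le:
  assumes f: "f \<in> borel_measurable (lebesgue_on {0..1})"
  shows "lorentz_norm \<phi> (cesaro_abs f) \<le> 6 * L1w_norm (weight \<phi>) f"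
proof -
  have "lorentz_norm \<phi> (cesaro_abs f) \<le> L1w_norm (\<lambda>t. stieltjes_integral (upper_kernel t)) f"
    by (intro lorentz_norm_le decr_rearr_cesaro_abs_le f) simp_all
  also have "\<dots> \<le> L1w_norm (\<lambda>t. stieltjes_integral (weight_kernel t) * 6) f"
    by (intro L1w_norm_mono upper_kernel_integral_le)
  also have "\<dots> = 6 * L1w_norm (weight \<phi>) f"
    using f by (simp add: L1w_norm_multc L1w_norm_weight mult.commute[of 6])
  finally show ?thesis .
qed

lemma lorentz_norm_cesaro_abs_ge:
  obtains C where "0 < C" "\<And>f. f \<in> borel_measurable (lebesgue_on {0..1}) \<Longrightarrow>
    L1w_norm (weight \<phi>) f \<le> ennreal C * lorentz_norm \<phi> (cesaro_abs f)"
proof -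
  obtain C where C: "0 < C" and weight_le: "\<And>t. 0 < t \<Longrightarrow> t \<le> 1 \<Longrightarrow> stieltjes_integral (weight_kernel t)
      \<le> (stieltjes_integral (near_zero_kernel t) + stieltjes_integral (near_one_kernel t)) * ennreal C"
    using weight_integral_le_near_kernels by metis
  have "L1w_norm (weight \<phi>) f \<le> ennreal (2 * C) * lorentz_norm \<phi> (cesaro_abs f)"
    if f: "f \<in> borel_measurable (lebesgue_on {0..1})" for f
  proof -
    let ?near_zero = "\<lambda>t. stieltjes_integral (near_zero_kernel t)"
    let ?near_one = "\<lambda>t. stieltjes_integral (near_one_kernel t)"
    have "L1w_norm (weight \<phi>) f \<le> L1w_norm (\<lambda>t. (?near_zero t + ?near_one t) * ennreal C) f"
      unfolding L1w_norm_weight by (intro L1w_norm_mono weight_le)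
    also have "\<dots> = (L1w_norm ?near_zero f + L1w_norm ?near_one f) * ennreal C"
      using f by (simp add: L1w_norm_multc L1w_norm_add)
    also have "\<dots> \<le> (lorentz_norm \<phi> (cesaro_abs f) + lorentz_norm \<phi> (cesaro_abs f)) * ennreal C"
      by (intro mult_right_mono add_mono le_lorentz_norm near_zero_kernel_le_decr_rearr
          near_one_kernel_le_decr_rearr f) simp_all
    also have "\<dots> = ennreal (2 * C) * lorentz_norm \<phi> (cesaro_abs f)"
      using C by (simp add: ennreal_mult mult_2 algebra_simps)
    finally show ?thesis .
  qed
  with C show thesis by (intro that[of "2 * C"]) auto
qed

end

theorem theorem10:
  fixes \<phi> :: "real \<Rightarrow> real" and p q :: real
  assumes incr: "mono_on {0..1} \<phi>"
    and conc: "concave_on {0..1} \<phi>"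
    and zero: "\<phi> 0 = 0"
    and pos: "\<And>t. 0 < t \<Longrightarrow> t \<le> 1 \<Longrightarrow> 0 < \<phi> t"
    and p_lim: "((\<lambda>s. ln (dil_fun \<phi> s) / ln s) \<longlongrightarrow> p) (at_right 0)"
    and q_lim: "((\<lambda>s. ln (dil_fun \<phi> s) / ln s) \<longlongrightarrow> q) at_top"
    and "0 < p" and "p \<le> q" and "q < 1"
  shows "\<exists>c1 c2. 0 < c1 \<and> 0 < c2 \<and>
           (\<forall>f \<in> borel_measurable (lebesgue_on {0..1}).
              ennreal c1 * L1w_norm (weight \<phi>) f \<le> lorentz_norm \<phi> (cesaro_abs f) \<and>
              lorentz_norm \<phi> (cesaro_abs f) \<le> ennreal c2 * L1w_norm (weight \<phi>) f)"
proof -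
  interpret lorentz_function \<phi>
    using incr conc zero pos dil_fun_tendsto_0[OF incr pos p_lim \<open>0 < p\<close>] by unfold_locales
  obtain C where C: "0 < C" and L1w_le: "\<And>f. f \<in> borel_measurable (lebesgue_on {0..1}) \<Longrightarrow>
      L1w_norm (weight \<phi>) f \<le> ennreal C * lorentz_norm \<phi> (cesaro_abs f)"
    using lorentz_norm_cesaro_abs_ge by metis
  have "ennreal (1 / C) * L1w_norm (weight \<phi>) f \<le> lorentz_norm \<phi> (cesaro_abs f)"
    if "f \<in> borel_measurable (lebesgue_on {0..1})" for f
  proof -
    have "ennreal (1 / C) * L1w_norm (weight \<phi>) f
        \<le> ennreal (1 / C) * (ennreal C * lorentz_norm \<phi> (cesaro_abs f))"
      using L1w_le[OF that] by (rule mult_left_mono) simp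
    also have "\<dots> = lorentz_norm \<phi> (cesaro_abs f)"
      using C by (simp flip: mult.assoc ennreal_mult)
    finally show ?thesis .
  qed
  then show ?thesis
    using C lorentz_norm_cesaro_abs_le by (intro exI[of _ "1 / C"] exI[of _ 6]) auto
qed

end
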